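(* Let $R$ be an $s$-unital ring and let $M_{\mathbb{Z}}(R)$ denote the ring of infinite $\mathbb{Z}\times\mathbb{Z}$-matrices with entries in $R$ having only finitely many nonzero entries. Then $M_{\mathbb{Z}}(R)$ is prime if and only if $R$ is prime.
   Context: Rings are associative but not necessarily unital; ideals are two-sided. A ring $R$ is $s$-unital if $r\in rR\cap Rr$ for every $r\in R$. A ring $R$ is prime if $\{0\}$ is a proper ideal and for all ideals $A,B$ of $R$, $AB=\{0\}$ implies $A=\{0\}$ or $B=\{0\}$. *)

theory Defs
  imports Main "HOL-Library.Groups_Big_Fun"
begin

text \<open>
  The type class \<open>ring\<close> consists of associative rings that need not have a unit
  (and may be the zero ring).
\<close>

definition s_unital :: "'a::ring itself \<Rightarrow> bool" where
  "s_unital _ \<longleftrightarrow> (\<forall>r::'a. r \<in> range (\<lambda>x. r * x) \<inter> range (\<lambda>x. x * r))"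

definition two_sided_ideal :: "'a::ring set \<Rightarrow> bool" where
  "two_sided_ideal I \<longleftrightarrow>
     0 \<in> I \<and> (\<forall>x\<in>I. \<forall>y\<in>I. x - y \<in> I) \<and> (\<forall>x\<in>I. \<forall>r. r * x \<in> I \<and> x * r \<in> I)"

definition ideal_product :: "'a::ring set \<Rightarrow> 'a set \<Rightarrow> 'a set" where
  "ideal_product A B =
     {\<Sum>i<n. a i * b i | (n::nat) a b. \<forall>i<n. a i \<in> A \<and> b i \<in> B}"

definition prime_ring :: "'a::ring itself \<Rightarrow> bool" where
  "prime_ring _ \<longleftrightarrow>
     two_sided_ideal {0::'a} \<and> {0::'a} \<noteq> UNIV \<and>
     (\<forall>A B :: 'a set. two_sided_ideal A \<longrightarrow> two_sided_ideal B \<longrightarrow>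
        ideal_product A B = {0} \<longrightarrow> A = {0} \<or> B = {0})"

typedef (overloaded) 'a int_matrix =
    "{f :: int \<Rightarrow> int \<Rightarrow> 'a::zero. finite {(i, j). f i j \<noteq> 0}}"
  morphisms entry Abs_int_matrix
  by (rule exI[of _ "\<lambda>_ _. 0"]) simp

setup_lifting type_definition_int_matrix

lemma int_matrix_eqI: "(\<And>i j. entry A i j = entry B i j) \<Longrightarrow> A = B"
  by (simp add: entry_inject[symmetric] fun_eq_iff)

instantiation int_matrix :: (ring) ring
begin

lift_definition zero_int_matrix :: "'a int_matrix" is "\<lambda>_ _. 0"
  by simp

lift_definition plus_int_matrix :: "'a int_matrix \<Rightarrow> 'a int_matrix \<Rightarrow> 'a int_matrix"
  is "\<lambda>f g i j. f i j + g i j"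
  subgoal for f g
    by (rule finite_subset[of _ "{(i, j). f i j \<noteq> 0} \<union> {(i, j). g i j \<noteq> 0}"]) auto
  done

lift_definition uminus_int_matrix :: "'a int_matrix \<Rightarrow> 'a int_matrix"
  is "\<lambda>f i j. - f i j"
  by simp

lift_definition minus_int_matrix :: "'a int_matrix \<Rightarrow> 'a int_matrix \<Rightarrow> 'a int_matrix"
  is "\<lambda>f g i j. f i j - g i j"
  subgoal for f g
    by (rule finite_subset[of _ "{(i, j). f i j \<noteq> 0} \<union> {(i, j). g i j \<noteq> 0}"]) auto
  done

lift_definition times_int_matrix :: "'a int_matrix \<Rightarrow> 'a int_matrix \<Rightarrow> 'a int_matrix"
  is "\<lambda>f g i k. Sum_any (\<lambda>j. f i j * g j k)"
proof -
  fix f g :: "int \<Rightarrow> int \<Rightarrow> 'a"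
  assume f: "finite {(i, j). f i j \<noteq> 0}" and g: "finite {(i, j). g i j \<noteq> 0}"
  have "{(i, k). Sum_any (\<lambda>j. f i j * g j k) \<noteq> 0}
      \<subseteq> fst ` {(i, j). f i j \<noteq> 0} \<times> snd ` {(i, j). g i j \<noteq> 0}"
  proof clarify
    fix i k assume "Sum_any (\<lambda>j. f i j * g j k) \<noteq> 0"
    then obtain j where "f i j * g j k \<noteq> 0"
      by (rule Sum_any.not_neutral_obtains_not_neutral)
    then have "f i j \<noteq> 0" "g j k \<noteq> 0" by auto
    then show "i \<in> fst ` {(i, j). f i j \<noteq> 0} \<and> k \<in> snd ` {(i, j). g i j \<noteq> 0}"
      by force
  qed
  then show "finite {(i, k). Sum_any (\<lambda>j. f i j * g j k) \<noteq> 0}"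
    by (rule finite_subset) (use f g in simp)
qed

lemma entry_times_superset:
  fixes A B :: "'a int_matrix"
  assumes "finite N" and "\<And>j. entry A i j \<noteq> 0 \<Longrightarrow> entry B j k \<noteq> 0 \<Longrightarrow> j \<in> N"
  shows "entry (A * B) i k = (\<Sum>j\<in>N. entry A i j * entry B j k)"
  unfolding times_int_matrix.rep_eq
  by (rule Sum_any.expand_superset) (use assms in \<open>auto intro!: assms(2)\<close>)

lemma finite_support_superset:
  fixes A :: "'a int_matrix"
  obtains N where "finite N" and "\<And>i j. entry A i j \<noteq> 0 \<Longrightarrow> i \<in> N \<and> j \<in> N"
proof
  have "finite {(i, j). entry A i j \<noteq> 0}"
    using entry[of A] by simp
  then show "finite (fst ` {(i, j). entry A i j \<noteq> 0} \<union> snd ` {(i, j). entry A i j \<noteq> 0})"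
    by simp
qed force

instance
proof
  fix A B C :: "'a int_matrix"
  show "A + B + C = A + (B + C)" by transfer (simp add: add.assoc)
  show "A + B = B + A" by transfer (simp add: add.commute)
  show "0 + A = A" by transfer simp
  show "- A + A = 0" by transfer simp
  show "A - B = A + - B" by transfer simp
  obtain NA where NA: "finite NA" "\<And>i j. entry A i j \<noteq> 0 \<Longrightarrow> i \<in> NA \<and> j \<in> NA"
    using finite_support_superset[of A] by blast
  obtain NB where NB: "finite NB" "\<And>i j. entry B i j \<noteq> 0 \<Longrightarrow> i \<in> NB \<and> j \<in> NB"
    using finite_support_superset[of B] by blast
  obtain NC where NC: "finite NC" "\<And>i j. entry C i j \<noteq> 0 \<Longrightarrow> i \<in> NC \<and> j \<in> NC"
    using finite_support_superset[of C] by blast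
  define N where "N = NA \<union> NB \<union> NC"
  have N: "finite N" using NA NB NC by (simp add: N_def)
  have A: "\<And>X i k. entry (A * X) i k = (\<Sum>j\<in>N. entry A i j * entry X j k)"
    using NA N by (intro entry_times_superset) (auto simp: N_def)
  have B: "\<And>X i k. entry (B * X) i k = (\<Sum>j\<in>N. entry B i j * entry X j k)"
    using NB N by (intro entry_times_superset) (auto simp: N_def)
  have C: "\<And>X i k. entry (X * C) i k = (\<Sum>j\<in>N. entry X i j * entry C j k)"
    using NC N by (intro entry_times_superset) (auto simp: N_def)
  show "A * B * C = A * (B * C)"
  proof (rule int_matrix_eqI)
    fix i l
    have "entry (A * B * C) i l = (\<Sum>k\<in>N. \<Sum>j\<in>N. entry A i j * (entry B j k * entry C k l))"
      by (simp add: C[of "A * B"] A[of B] sum_distrib_right mult.assoc)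
    also have "\<dots> = (\<Sum>j\<in>N. \<Sum>k\<in>N. entry A i j * (entry B j k * entry C k l))"
      by (rule sum.swap)
    also have "\<dots> = entry (A * (B * C)) i l"
      by (simp add: A[of "B * C"] B[of C] sum_distrib_left)
    finally show "entry (A * B * C) i l = entry (A * (B * C)) i l" .
  qed
  show "(A + B) * C = A * C + B * C"
    by (rule int_matrix_eqI)
      (simp add: C plus_int_matrix.rep_eq distrib_right sum.distrib)
  show "A * (B + C) = A * B + A * C"
    by (rule int_matrix_eqI)
      (simp add: A plus_int_matrix.rep_eq distrib_left sum.distrib)
qed

end

end

theory Submission
  imports Defs
begin

text \<open>
  Both directions move ideals between \<open>R\<close> and its matrix ring. An ideal \<open>A\<close> of \<open>R\<close> gives the
  ideal of matrices with entries in \<open>A\<close>, and an ideal \<open>I\<close> of the matrix ring gives the ideal of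
  those \<open>r\<close> with \<open>r e\<^sub>0\<^sub>0 \<in> I\<close>. The second passage detects nonzero ideals because \<open>R\<close> is
  \<open>s\<close>-unital: if \<open>r = X\<^sub>i\<^sub>j\<close> for some \<open>X \<in> I\<close> and \<open>r = u r = r v\<close>,
  then \<open>r e\<^sub>0\<^sub>0 = (u e\<^sub>0\<^sub>i) X (v e\<^sub>j\<^sub>0) \<in> I\<close>.
\<close>

text \<open>One-term sums give the products \<open>a * b\<close>, and a sum of zeros is zero.
  Primeness can thus be tested on products of elements.\<close>

lemma ideal_product_eq_zero_iff:
  "ideal_product A B = {0} \<longleftrightarrow> (\<forall>a\<in>A. \<forall>b\<in>B. a * b = 0)"
proof
  assume prod: "ideal_product A B = {0}"
  show "\<forall>a\<in>A. \<forall>b\<in>B. a * b = 0"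
  proof (intro ballI)
    fix a b assume "a \<in> A" "b \<in> B"
    then have "a * b \<in> ideal_product A B"
      unfolding ideal_product_def
      by (intro CollectI exI[of _ "1 :: nat"] exI[of _ "\<lambda>_. a"] exI[of _ "\<lambda>_. b"]) simp
    with prod show "a * b = 0" by simp
  qed
next
  assume "\<forall>a\<in>A. \<forall>b\<in>B. a * b = 0"
  then show "ideal_product A B = {0}"
    \<comment> \<open>The witness 0 for \<open>n\<close> is the empty sum, which puts
      \<open>0\<close> in the product even if \<open>A\<close> or \<open>B\<close> is empty.\<close>
    unfolding ideal_product_def by (auto intro!: sum.neutral exI[of _ 0])
qed

lemma two_sided_ideal_zero: "two_sided_ideal {0}"
  by (simp add: two_sided_ideal_def)

lemma two_sided_ideal_add:
  assumes I: "two_sided_ideal I" and "x \<in> I" "y \<in> I"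
  shows "x + y \<in> I"
proof -
  have diff: "a - b \<in> I" if "a \<in> I" "b \<in> I" for a b
    using I that by (simp add: two_sided_ideal_def)
  have "0 - y \<in> I"
    using I \<open>y \<in> I\<close> by (intro diff) (auto simp: two_sided_ideal_def)
  from diff[OF \<open>x \<in> I\<close> this] show ?thesis by simp
qed

lemma two_sided_ideal_sum:
  assumes "two_sided_ideal I" and "\<And>x. x \<in> N \<Longrightarrow> f x \<in> I"
  shows "sum f N \<in> I"
  using assms(2)
proof (induction N rule: infinite_finite_induct)
  case (insert x N)
  then show ?case using assms(1) by (simp add: two_sided_ideal_add)
qed (use assms(1) in \<open>auto simp: two_sided_ideal_def\<close>)

text \<open>The coefficient is built in because \<open>R\<close> may lack a unit, so there may be no
  matrix unit to scale.\<close>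

lift_definition single_entry :: "int \<Rightarrow> int \<Rightarrow> 'a::zero \<Rightarrow> 'a int_matrix"
  is "\<lambda>i j r k l. if k = i \<and> l = j then r else 0"
  subgoal for i j r
    by (rule finite_subset[of _ "{(i, j)}"]) auto
  done

lemma entry_single_entry_times:
  "entry (single_entry i j r * X) k l = (if k = i then r * entry X j l else 0)"
  by (subst entry_times_superset[of "{j}"]) (auto simp: single_entry.rep_eq split: if_splits)

lemma entry_times_single_entry:
  "entry (X * single_entry i j r) k l = (if l = j then entry X k i * r else 0)"
  by (subst entry_times_superset[of "{i}"]) (auto simp: single_entry.rep_eq split: if_splits)

text \<open>The left factor moves row \<open>j\<close> to row \<open>i\<close>, the right one moves
  column \<open>k\<close> to column \<open>l\<close>, and all else is cleared.\<close>

lemma single_entry_times: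
  "single_entry i j r * X * single_entry k l s = single_entry i l (r * entry X j k * s)"
  by (rule int_matrix_eqI)
    (simp add: entry_single_entry_times entry_times_single_entry single_entry.rep_eq)

lemma single_entry_mult_single_entry:
  "single_entry i j r * single_entry j k s = single_entry i k (r * s)"
  by (rule int_matrix_eqI) (simp add: entry_single_entry_times single_entry.rep_eq)

lemma single_entry_diff: "single_entry i j (r - s) = single_entry i j r - single_entry i j s"
  by (rule int_matrix_eqI) (simp add: minus_int_matrix.rep_eq single_entry.rep_eq)

lemma single_entry_0 [simp]: "single_entry i j 0 = 0"
  by transfer simp

lemma single_entry_eq_0_iff [simp]: "single_entry i j r = 0 \<longleftrightarrow> r = 0"
  by transfer (auto simp: fun_eq_iff)

definition matrices_over :: "'a::zero set \<Rightarrow> 'a int_matrix set" where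
  "matrices_over A = {X. \<forall>i j. entry X i j \<in> A}"

lemma single_entry_in_matrices_over:
  "0 \<in> A \<Longrightarrow> a \<in> A \<Longrightarrow> single_entry i j a \<in> matrices_over A"
  by (simp add: matrices_over_def single_entry.rep_eq)

text \<open>Finite support makes the entry a finite sum of elements of \<open>I\<close>.\<close>

lemma entry_times_in_ideal:
  assumes "two_sided_ideal I" and "\<And>j. entry X i j * entry Y j k \<in> I"
  shows "entry (X * Y) i k \<in> I"
proof -
  obtain N where N: "finite N" "\<And>i j. entry X i j \<noteq> 0 \<Longrightarrow> i \<in> N \<and> j \<in> N"
    using finite_support_superset[of X] by blast
  then have "entry (X * Y) i k = (\<Sum>j\<in>N. entry X i j * entry Y j k)"
    by (intro entry_times_superset) auto
  also have "\<dots> \<in> I"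
    using assms by (rule two_sided_ideal_sum)
  finally show ?thesis .
qed

lemma two_sided_ideal_matrices_over:
  assumes A: "two_sided_ideal A"
  shows "two_sided_ideal (matrices_over A)"
  using A entry_times_in_ideal[OF A]
  by (auto simp: two_sided_ideal_def matrices_over_def zero_int_matrix.rep_eq
      minus_int_matrix.rep_eq)

lemma matrices_over_mult_eq_zero:
  assumes "\<forall>a\<in>A. \<forall>b\<in>B. a * b = 0" and "X \<in> matrices_over A" "Y \<in> matrices_over B"
  shows "X * Y = 0"
proof (rule int_matrix_eqI)
  fix i k
  \<comment> \<open>Vanishing is read as membership in the zero ideal.\<close>
  have "entry (X * Y) i k \<in> {0}"
    by (rule entry_times_in_ideal[OF two_sided_ideal_zero])
      (use assms in \<open>auto simp: matrices_over_def\<close>)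
  then show "entry (X * Y) i k = entry 0 i k"
    by (simp add: zero_int_matrix.rep_eq)
qed

definition corner :: "'a::ring int_matrix set \<Rightarrow> 'a set" where
  "corner I = {r. single_entry 0 0 r \<in> I}"

lemma two_sided_ideal_corner:
  assumes "two_sided_ideal I"
  shows "two_sided_ideal (corner I)"
  using assms
  by (auto simp: two_sided_ideal_def corner_def single_entry_diff
      \<comment> \<open>Factoring the corner matrix of \<open>r * s\<close> into those of
        \<open>r\<close> and \<open>s\<close> lets absorption in \<open>I\<close> pass to the
        corner.\<close>
      single_entry_mult_single_entry[of 0 0 _ 0, symmetric])

lemma entry_in_corner:
  assumes "s_unital TYPE('a::ring)" and I: "two_sided_ideal I" and "X \<in> I"
  shows "entry X i j \<in> corner (I :: 'a int_matrix set)"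
proof -
  define r where "r = entry X i j"
  \<comment> \<open>Here \<open>s\<close>-unitality enters: \<open>u\<close> and \<open>v\<close>
    depend on the entry \<open>r\<close> and act as one-sided units for it.\<close>
  obtain u v where uv: "r * v = r" "u * r = r"
    using assms(1) unfolding s_unital_def by (metis Int_iff rangeE)
  have "single_entry 0 i u * X * single_entry j 0 v \<in> I"
    using I \<open>X \<in> I\<close> by (simp add: two_sided_ideal_def)
  then show ?thesis
    by (simp add: single_entry_times corner_def uv flip: r_def)
qed

lemma corner_eq_zero_imp:
  assumes "s_unital TYPE('a::ring)" and I: "two_sided_ideal I"
    and "corner I = {0}"
  shows "I = {0 :: 'a int_matrix}"
proof -
  have "X = 0" if "X \<in> I" for X
    using entry_in_corner[OF assms(1) I that] \<open>corner I = {0}\<close>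
    by (intro int_matrix_eqI) (simp add: zero_int_matrix.rep_eq)
  then show ?thesis
    using I by (auto simp: two_sided_ideal_def)
qed

text \<open>This transfers the clause of primeness that the zero ideal is proper.\<close>

lemma int_matrix_trivial_iff:
  "({0 :: 'a::ring int_matrix} = UNIV) \<longleftrightarrow> ({0 :: 'a} = UNIV)"
proof
  assume "{0 :: 'a int_matrix} = UNIV"
  then have "single_entry 0 0 r = 0" for r :: 'a by blast
  then show "{0 :: 'a} = UNIV" by auto
next
  assume "{0 :: 'a} = UNIV"
  then have zero: "r = 0" for r :: 'a by blast
  have "X = 0" for X :: "'a int_matrix"
    by (rule int_matrix_eqI) (metis zero)
  then show "{0 :: 'a int_matrix} = UNIV" by auto
qed

lemma prime_ring_int_matrix_imp:
  assumes prime: "prime_ring TYPE('a::ring int_matrix)"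
  shows "prime_ring TYPE('a)"
  unfolding prime_ring_def ideal_product_eq_zero_iff
proof (intro conjI allI impI)
  show "{0 :: 'a} \<noteq> UNIV"
    using prime by (simp add: prime_ring_def int_matrix_trivial_iff)
next
  fix A B :: "'a set"
  assume A: "two_sided_ideal A" and B: "two_sided_ideal B" and AB: "\<forall>a\<in>A. \<forall>b\<in>B. a * b = 0"
  have zero: "0 \<in> A" "0 \<in> B"
    using A B by (auto simp: two_sided_ideal_def)
  have "matrices_over A = {0} \<or> matrices_over B = {0}"
    using prime A B matrices_over_mult_eq_zero[OF AB]
    by (simp add: prime_ring_def ideal_product_eq_zero_iff two_sided_ideal_matrices_over)
  \<comment> \<open>Each \<open>c\<close> in \<open>C\<close> shows up as a matrix with sole entry
    \<open>c\<close>, which must be zero.\<close>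
  moreover have "C = {0}" if "matrices_over C = {0}" "0 \<in> C" for C :: "'a set"
    using that single_entry_in_matrices_over[of C _ 0 0] by auto
  ultimately show "A = {0} \<or> B = {0}"
    using zero by blast
qed (rule two_sided_ideal_zero)

lemma prime_ring_imp_int_matrix:
  assumes s: "s_unital TYPE('a::ring)" and prime: "prime_ring TYPE('a)"
  shows "prime_ring TYPE('a int_matrix)"
  unfolding prime_ring_def ideal_product_eq_zero_iff
proof (intro conjI allI impI)
  show "{0 :: 'a int_matrix} \<noteq> UNIV"
    using prime by (simp add: prime_ring_def int_matrix_trivial_iff)
next
  fix I J :: "'a int_matrix set"
  assume I: "two_sided_ideal I" and J: "two_sided_ideal J" and IJ: "\<forall>x\<in>I. \<forall>y\<in>J. x * y = 0"
  \<comment> \<open>The product of the corner matrices of \<open>a\<close> and \<open>b\<close> is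
    zero and has \<open>a * b\<close> in its corner.\<close>
  have "a * b = 0" if "a \<in> corner I" "b \<in> corner J" for a b
  proof -
    have "single_entry 0 0 a * single_entry 0 0 b = 0"
      using that IJ by (simp add: corner_def)
    then show ?thesis by (simp add: single_entry_mult_single_entry)
  qed
  then have "corner I = {0} \<or> corner J = {0}"
    using prime I J by (simp add: prime_ring_def ideal_product_eq_zero_iff two_sided_ideal_corner)
  then show "I = {0} \<or> J = {0}"
    using corner_eq_zero_imp[OF s] I J by blast
qed (rule two_sided_ideal_zero)

theorem corollary11p3:
  assumes "s_unital TYPE('a::ring)"
  shows "prime_ring TYPE('a int_matrix) \<longleftrightarrow> prime_ring TYPE('a)"
  using prime_ring_int_matrix_imp prime_ring_imp_int_matrix[OF assms] by blast

end
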